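(* Let $\sigma$ be an irreducible incommensurable normalized multiscale substitution scheme in $\mathbb{R}^d$, and let $\mathcal{S}\in\mathbb{X}_\sigma^F$ be a stationary tiling. Let $\mathcal{P}$ be a patch in $\mathcal{S}$, and let $I_{\mathcal{P}}=(\beta^{\min}_{\mathcal{P}},\beta^{\max}_{\mathcal{P}}]$ be the interval of legal scales of $\mathcal{P}$ in $\mathcal{S}$. Then the set $$\mathrm{Scales}(\mathcal{S},\mathcal{P}):=\{\alpha:\ \mathcal{S}\text{ contains a translated copy of }\alpha\mathcal{P}\}$$ is dense in $I_{\mathcal{P}}$.
   Context: Schemes. A tile in $\mathbb{R}^d$ is a bounded Lebesgue measurable set $T$ of positive measure $\mathrm{vol}\,T$ whose boundary has measure zero. A tessellation of $U\subset\mathbb{R}^d$ is a collection of tiles with pairwise disjoint interiors and union $U$; it is called a patch if $U$ is bounded ($U$ is then the support of the patch) and a tiling if $U=\mathbb{R}^d$. A multiscale substitution scheme $\sigma=(\tau_\sigma,\varrho_\sigma)$ consists of a finite list of prototiles $\tau_\sigma=(T_1,\dots,T_n)$ and, for each $i$, a tessellation $\varrho_\sigma(T_i)$ of $T_i$ all of whose tiles are translates of rescaled prototiles $\alpha T_j$, with all $\alpha\in(0,1)$. A translate of $\alpha T_j$, $\alpha>0$, is a tile of type $j$ and scale $\alpha$. Standing assumptions: $\sigma$ is normalized, i.e. $\mathrm{vol}\,T_i=1$ for all $i$; distinct prototiles are geometrically different ($T_i$ is not a rescaled copy of $T_j$ for $i\ne j$), so the type of a tile is determined by the tile. Substitution semi-flow.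 For $t\ge 0$, $F_t(T_i)$ is the patch supported on $e^tT_i$ obtained by starting with $e^tT_i$ and repeatedly substituting (according to the rescaled rule $\varrho_\sigma$) every tile of volume $>1$, until all tiles have volume $\le 1$. In the same way $F_t$ is defined on every tile $T$ that is a translate of $\alpha T_i$ with $0<\alpha\le 1$ ($F_t(T)$ is supported on $e^tT$), on patches of such tiles, and on tilings by such tiles (tile by tile). $\sigma$ is irreducible if for all $i,j$ there is $t>0$ such that $F_t(T_i)$ contains a tile of type $j$. $\sigma$ is incommensurable if there are $i,j$ and $t_1,t_2>0$ with $t_1\notin\mathbb{Q}t_2$ such that $F_{t_1}(T_i)$ contains a tile of type $i$ and unit volume and $F_{t_2}(T_j)$ contains a tile of type $j$ and unit volume. Let $\mathscr{S}_{i\to i}$ be the set of $t$ such that $F_t(T_i)$ contains a tile of type $i$ and unit volume. Tiling space. Let $\mathscr{P}_\sigma=\{F_t(T_i): t\ge0,\ i=1,\dots,n\}$. Identify a patch or tiling with the closed set which is the union of the boundaries of its tiles. On closed subsets of $\mathbb{R}^d$ use the metric $D(A_1,A_2)=\inf(\{r>0: A_1\cap B(0,1/r)\subset A_2^{+r},\ A_2\cap B(0,1/r)\subset A_1^{+r}\}\cup\{1\})$, where $A^{+r}$ is the $r$-neighborhood of $A$ and $B(x,R)$ is the open Euclidean ball. $\mathbb{X}^F_\sigma$ is the set of all tilings $\mathcal{T}$ of $\mathbb{R}^d$ such that every sub-patch of $\mathcal{T}$ is a limit, with respect to $D$, of translated sub-patches of elements of $\mathscr{P}_\sigma$. A stationary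 tiling is a tiling $\mathcal{S}\in\mathbb{X}_\sigma^F$ of the form $\mathcal{S}=\bigcup_{k\ge0}F_{a+ks}(T_i)$ with $0<s\in\mathscr{S}_{i\to i}$, $a\ge0$, where $T_i$ is positioned so that the origin is an interior point and the patches $F_{a+ks}(T_i)$, $k\ge0$, are nested (each a sub-patch of the next). It satisfies $F_s(\mathcal{S})=\mathcal{S}$, and it can be written as a nested union $\mathcal{S}=\bigcup_{k\ge0}F_{ks}(T)$ with $T$ a single tile, a rescaled copy of a prototile. Interval of legal scales of a patch. Let $\mathcal{P}_0$ be a (non-empty, finite) patch in $\mathcal{S}=\bigcup_{k\ge 0}F_{ks}(T)$ and let $k\ge1$ be smallest such that $\mathcal{P}_0$ is a sub-patch of $F_{ks}(T)$. Let $t_{\mathcal{P}_0}=(t_{\min},t_{\max}]$ be the maximal interval containing $ks$ such that for every $t\in t_{\mathcal{P}_0}$ the patch $F_t(T)$ contains the corresponding rescaled copy $e^{t-ks}\mathcal{P}_0$ of $\mathcal{P}_0$ as a sub-patch, and let $I'_{\mathcal{P}_0}=\{e^{t-ks}:t\in t_{\mathcal{P}_0}\}$ be the corresponding interval of scales (with $\mathcal{P}_0$ itself having scale $1$). For a patch $\mathcal{P}$ in $\mathcal{S}$, let $(\mathcal{P}_j)_{j\ge1}$ enumerate all translated copies of $\mathcal{P}$ in $\mathcal{S}$. The interval of legal scales of $\mathcal{P}$ in $\mathcal{S}$ is $I_{\mathcal{P}}:=\bigcup_j I'_{\mathcal{P}_j}$; all $I'_{\mathcal{P}_j}$ have the same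 maximum $\beta^{\max}_{\mathcal{P}}$ and contain $1$ and a left neighborhood of $1$, so $I_{\mathcal{P}}$ is an interval of the form $(\beta^{\min}_{\mathcal{P}},\beta^{\max}_{\mathcal{P}}]$. *)

theory Defs
  imports "HOL-Analysis.Analysis"
begin

text \<open>Euclidean space \<open>\<real>\<^sup>d\<close> is a type \<open>'a :: euclidean_space\<close> with \<open>d = DIM('a)\<close>. Patches and
  tilings are sets of tiles; nothing is lost by using sets instead of lists, because tiles have
  non-empty interior (positive volume, null boundary), so tiles with disjoint interiors are
  distinct.\<close>

abbreviation vol :: "'a::euclidean_space set \<Rightarrow> real" where
  "vol \<equiv> measure lebesgue"

definition tile :: "'a::euclidean_space set \<Rightarrow> bool" where
  "tile T \<longleftrightarrow> bounded T \<and> T \<in> sets lebesgue \<and> vol T > 0 \<and> negligible (frontier T)"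

definition tessellation :: "'a::euclidean_space set set \<Rightarrow> 'a set \<Rightarrow> bool" where
  "tessellation \<T> U \<longleftrightarrow>
     (\<forall>T\<in>\<T>. tile T) \<and> pairwise (\<lambda>A B. interior A \<inter> interior B = {}) \<T> \<and> \<Union>\<T> = U"

definition patch :: "'a::euclidean_space set set \<Rightarrow> bool" where
  "patch \<P> \<longleftrightarrow> tessellation \<P> (\<Union>\<P>) \<and> bounded (\<Union>\<P>)"

definition tiling :: "'a::euclidean_space set set \<Rightarrow> bool" where
  "tiling \<T> \<longleftrightarrow> tessellation \<T> UNIV"

text \<open>\<open>copy v \<alpha> A\<close> is \<open>v + \<alpha> A\<close>. The copy \<open>v + \<alpha> \<P>\<close> of a patch \<open>\<P>\<close> is \<open>copy v \<alpha> ` \<P>\<close>.\<close>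

definition copy :: "'a::real_vector \<Rightarrow> real \<Rightarrow> 'a set \<Rightarrow> 'a set" where
  "copy v \<alpha> A = (\<lambda>x. v + \<alpha> *\<^sub>R x) ` A"


text \<open>The prototiles are indexed by \<open>0, ..., n - 1\<close>; \<open>rule \<sigma> i\<close> is the tessellation of the
  prototile with index \<open>i\<close> (its values for \<open>i \<ge> n\<close> are irrelevant).\<close>

record 'a scheme =
  prototiles :: "'a set list"
  rule :: "nat \<Rightarrow> 'a set set"

abbreviation num_types :: "('a, 'b) scheme_scheme \<Rightarrow> nat" where
  "num_types \<sigma> \<equiv> length (prototiles \<sigma>)"

abbreviation prototile :: "('a, 'b) scheme_scheme \<Rightarrow> nat \<Rightarrow> 'a set" where
  "prototile \<sigma> i \<equiv> prototiles \<sigma> ! i"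

definition has_type :: "'a::euclidean_space scheme \<Rightarrow> nat \<Rightarrow> 'a set \<Rightarrow> bool" where
  "has_type \<sigma> i T \<longleftrightarrow> (\<exists>v \<alpha>. \<alpha> > 0 \<and> T = copy v \<alpha> (prototile \<sigma> i))"

definition multiscale_scheme :: "'a::euclidean_space scheme \<Rightarrow> bool" where
  "multiscale_scheme \<sigma> \<longleftrightarrow>
     (\<forall>i < num_types \<sigma>. tile (prototile \<sigma> i)) \<and>
     (\<forall>i < num_types \<sigma>. tessellation (rule \<sigma> i) (prototile \<sigma> i) \<and>
        (\<forall>T \<in> rule \<sigma> i. \<exists>j < num_types \<sigma>. \<exists>v \<alpha>. 0 < \<alpha> \<and> \<alpha> < 1 \<and>
           T = copy v \<alpha> (prototile \<sigma> j)))"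

definition normalized :: "'a::euclidean_space scheme \<Rightarrow> bool" where
  "normalized \<sigma> \<longleftrightarrow> (\<forall>i < num_types \<sigma>. vol (prototile \<sigma> i) = 1)"

definition geometrically_different :: "'a::euclidean_space scheme \<Rightarrow> bool" where
  "geometrically_different \<sigma> \<longleftrightarrow>
     (\<forall>i < num_types \<sigma>. \<forall>j < num_types \<sigma>. i \<noteq> j \<longrightarrow> \<not> has_type \<sigma> j (prototile \<sigma> i))"


text \<open>\<open>pieces \<sigma> X\<close> consists of all tiles that occur at any stage of the process which starts
  with \<open>X\<close> and keeps substituting tiles of volume \<open>> 1\<close>. The tiles left over when the process
  stops are those of volume \<open>\<le> 1\<close>.\<close>

inductive_set pieces :: "'a::euclidean_space scheme \<Rightarrow> 'a set \<Rightarrow> 'a set set"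
  for \<sigma> :: "'a scheme" and X :: "'a set" where
  start: "X \<in> pieces \<sigma> X"
| subst: "\<lbrakk>copy v \<alpha> (prototile \<sigma> j) \<in> pieces \<sigma> X; j < num_types \<sigma>; \<alpha> > 0;
    vol (copy v \<alpha> (prototile \<sigma> j)) > 1; R \<in> rule \<sigma> j\<rbrakk> \<Longrightarrow> copy v \<alpha> R \<in> pieces \<sigma> X"

text \<open>The patch \<open>F\<^sub>t(T)\<close>, supported on \<open>e\<^sup>t T\<close>, for a tile \<open>T\<close> (a copy of a prototile of any scale)
  and any real \<open>t\<close>. In particular \<open>F\<^sub>t(T) = {e\<^sup>t T}\<close> whenever \<open>e\<^sup>t T\<close> has volume \<open>\<le> 1\<close>.\<close>

definition flow :: "'a::euclidean_space scheme \<Rightarrow> real \<Rightarrow> 'a set \<Rightarrow> 'a set set" where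
  "flow \<sigma> t T = {S \<in> pieces \<sigma> (copy 0 (exp t) T). vol S \<le> 1}"

definition irreducible_scheme :: "'a::euclidean_space scheme \<Rightarrow> bool" where
  "irreducible_scheme \<sigma> \<longleftrightarrow>
     (\<forall>i < num_types \<sigma>. \<forall>j < num_types \<sigma>. \<exists>t > 0. \<exists>S \<in> flow \<sigma> t (prototile \<sigma> i). has_type \<sigma> j S)"

definition return_times :: "'a::euclidean_space scheme \<Rightarrow> nat \<Rightarrow> real set" where
  "return_times \<sigma> i =
     {t. t \<ge> 0 \<and> (\<exists>S \<in> flow \<sigma> t (prototile \<sigma> i). has_type \<sigma> i S \<and> vol S = 1)}"

definition incommensurable :: "'a::euclidean_space scheme \<Rightarrow> bool" where
  "incommensurable \<sigma> \<longleftrightarrow>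
     (\<exists>i < num_types \<sigma>. \<exists>j < num_types \<sigma>. \<exists>t\<^sub>1 > 0. \<exists>t\<^sub>2 > 0.
        (\<forall>q \<in> \<rat>. t\<^sub>1 \<noteq> q * t\<^sub>2) \<and> t\<^sub>1 \<in> return_times \<sigma> i \<and> t\<^sub>2 \<in> return_times \<sigma> j)"


definition boundary_set :: "'a::euclidean_space set set \<Rightarrow> 'a set" where
  "boundary_set \<T> = (\<Union>T\<in>\<T>. frontier T)"

definition neighborhood :: "'a::euclidean_space set \<Rightarrow> real \<Rightarrow> 'a set" where
  "neighborhood A r = (\<Union>a\<in>A. ball a r)"

definition D_dist :: "'a::euclidean_space set \<Rightarrow> 'a set \<Rightarrow> real" where
  "D_dist A\<^sub>1 A\<^sub>2 = Inf ({r. r > 0 \<and> A\<^sub>1 \<inter> ball 0 (1 / r) \<subseteq> neighborhood A\<^sub>2 r \<and>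
                              A\<^sub>2 \<inter> ball 0 (1 / r) \<subseteq> neighborhood A\<^sub>1 r} \<union> {1})"

definition generating_patches :: "'a::euclidean_space scheme \<Rightarrow> 'a set set set" where
  "generating_patches \<sigma> = {flow \<sigma> t (prototile \<sigma> i) | t i. t \<ge> 0 \<and> i < num_types \<sigma>}"

definition tiling_space :: "'a::euclidean_space scheme \<Rightarrow> 'a set set set" where
  "tiling_space \<sigma> = {\<T>. tiling \<T> \<and>
     (\<forall>\<Q>. \<Q> \<subseteq> \<T> \<and> patch \<Q> \<longrightarrow>
        (\<exists>\<R> v. (\<forall>m :: nat. patch (\<R> m) \<and> (\<exists>\<P> \<in> generating_patches \<sigma>. \<R> m \<subseteq> \<P>)) \<and>
           (\<lambda>m. D_dist (boundary_set (copy (v m) 1 ` \<R> m)) (boundary_set \<Q>)) \<longlonglongrightarrow> 0))}"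


definition stationary_tiling ::
    "'a::euclidean_space scheme \<Rightarrow> real \<Rightarrow> 'a set set \<Rightarrow> bool" where
  "stationary_tiling \<sigma> s \<S> \<longleftrightarrow> \<S> \<in> tiling_space \<sigma> \<and>
     (\<exists>i < num_types \<sigma>. \<exists>a \<ge> 0. \<exists>v. 0 < s \<and> s \<in> return_times \<sigma> i \<and>
        (let T = copy v 1 (prototile \<sigma> i) in
           0 \<in> interior T \<and>
           (\<forall>k :: nat. flow \<sigma> (a + real k * s) T \<subseteq> flow \<sigma> (a + real (Suc k) * s) T) \<and>
           \<S> = (\<Union>k :: nat. flow \<sigma> (a + real k * s) T)))"

text \<open>A presentation \<open>\<S> = \<Union>\<^sub>k F\<^sub>k\<^sub>s(T)\<close> as a nested union starting from a single tile. The scale of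
  \<open>T\<close> is not required to be \<open>\<le> 1\<close>: in the definition of a stationary tiling one can always take
  \<open>T = e\<^sup>a T\<^sub>i\<close>, whereas a presentation with \<open>T\<close> of scale \<open>\<le> 1\<close> need not exist when the origin lies
  on the boundary of a tile of \<open>\<S>\<close>.\<close>

definition presented_by ::
    "'a::euclidean_space scheme \<Rightarrow> real \<Rightarrow> 'a set \<Rightarrow> 'a set set \<Rightarrow> bool" where
  "presented_by \<sigma> s T \<S> \<longleftrightarrow> (\<exists>j < num_types \<sigma>. has_type \<sigma> j T) \<and>
     (\<forall>k :: nat. flow \<sigma> (real k * s) T \<subseteq> flow \<sigma> (real (Suc k) * s) T) \<and>
     \<S> = (\<Union>k :: nat. flow \<sigma> (real k * s) T)"

definition entry_index ::
    "'a::euclidean_space scheme \<Rightarrow> real \<Rightarrow> 'a set \<Rightarrow> 'a set set \<Rightarrow> nat" where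
  "entry_index \<sigma> s T \<P> = (LEAST k. k \<ge> 1 \<and> \<P> \<subseteq> flow \<sigma> (real k * s) T)"

definition maximal_interval :: "real set \<Rightarrow> real \<Rightarrow> real set" where
  "maximal_interval G x = \<Union>{J. is_interval J \<and> x \<in> J \<and> J \<subseteq> G}"

text \<open>Here \<open>t\<close> ranges over all reals. If \<open>T\<close> has scale \<open>\<le> 1\<close>, negative \<open>t\<close> contribute nothing; if
  \<open>T = e\<^sup>a T\<^sub>i\<close>, they amount to the patches \<open>F\<^sub>a\<^sub>+\<^sub>t(T\<^sub>i)\<close>, and allowing them makes the interval
  left-open in this case, too.\<close>

definition legal_times ::
    "'a::euclidean_space scheme \<Rightarrow> real \<Rightarrow> 'a set \<Rightarrow> 'a set set \<Rightarrow> real set" where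
  "legal_times \<sigma> s T \<P> =
     (let \<kappa> = real (entry_index \<sigma> s T \<P>) * s in
        maximal_interval {t. copy 0 (exp (t - \<kappa>)) ` \<P> \<subseteq> flow \<sigma> t T} \<kappa>)"

definition local_legal_scales ::
    "'a::euclidean_space scheme \<Rightarrow> real \<Rightarrow> 'a set \<Rightarrow> 'a set set \<Rightarrow> real set" where
  "local_legal_scales \<sigma> s T \<P> =
     (\<lambda>t. exp (t - real (entry_index \<sigma> s T \<P>) * s)) ` legal_times \<sigma> s T \<P>"

definition legal_scales ::
    "'a::euclidean_space scheme \<Rightarrow> real \<Rightarrow> 'a set \<Rightarrow> 'a set set \<Rightarrow> 'a set set \<Rightarrow> real set" where
  "legal_scales \<sigma> s T \<S> \<P> =
     (\<Union>v \<in> {v. copy v 1 ` \<P> \<subseteq> \<S>}. local_legal_scales \<sigma> s T (copy v 1 ` \<P>))"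

definition Scales :: "'a::euclidean_space set set \<Rightarrow> 'a set set \<Rightarrow> real set" where
  "Scales \<S> \<P> = {\<alpha>. \<alpha> > 0 \<and> (\<exists>v. copy v \<alpha> ` \<P> \<subseteq> \<S>)}"

end

theory Submission
  imports Defs
begin

text \<open>
  Record the substitution rules as a weighted graph on the types: a tile of scale \<open>\<alpha>\<close> and type \<open>k\<close>
  in the rule of type \<open>j\<close> is an edge from \<open>j\<close> to \<open>k\<close> of length \<open>- ln \<alpha>\<close>. As the tiles of volume
  \<open>> 1\<close> are the ones which get substituted, a walk of ratio \<open>\<beta>\<close> from \<open>j\<close> to \<open>k\<close> yields a tile of
  type \<open>k\<close> and scale \<open>\<gamma> \<beta>\<close> during the substitution of a tile of type \<open>j\<close> and scale \<open>\<gamma>\<close>,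
  provided that \<open>\<gamma> \<beta> > 1\<close> (\<open>descends_imp_piece\<close>), and all tiles that ever occur arise in this way
  (\<open>piece_imp_descends\<close>).

  Let \<open>T\<close> be of type \<open>j\<close> and let a closed walk at \<open>j\<close> have length \<open>\<l>\<close>. Going around it \<open>n\<close> times
  while \<open>e\<^bsup>m s\<^esup> T\<close> is being substituted produces a translate of \<open>e\<^sup>u T\<close>, where \<open>u = m s - n \<l>\<close>,
  as long as this tile has volume \<open>> 1\<close>. Its own substitution continues inside \<open>F\<^bsub>m s\<^esub>(T)\<close>, and hence
  the tiling \<open>\<S>\<close> contains a translate of the patch \<open>F\<^sub>u(T)\<close> (\<open>translated_flow_in_tiling\<close>).
  Irreducibility and incommensurability give a closed walk at \<open>j\<close> whose length is not a rational
  multiple of \<open>s\<close> (\<open>loop_incommensurable_with\<close>), and then the numbers \<open>m s - n \<l>\<close> with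
  \<open>m, n \<in> \<nat>\<close> are dense in \<open>\<real>\<close> by Kronecker's theorem (\<open>natural_differences_dense\<close>).

  A legal scale of \<open>\<P>\<close> is of the form \<open>e\<^bsup>t - \<kappa>\<^esup>\<close>, where \<open>t\<close> lies in an interval \<open>J\<close> around \<open>\<kappa>\<close> all
  of whose times \<open>u\<close> have the property that \<open>F\<^sub>u(T)\<close> contains a translate of \<open>e\<^bsup>u - \<kappa>\<^esup> \<P>\<close>. Unless \<open>J\<close>
  is a point, in which case the scale is \<open>1\<close>, the times \<open>u = m s - n \<l>\<close> in \<open>J\<close> accumulate at \<open>t\<close>,
  and for each of them \<open>\<S>\<close> contains a translate of \<open>F\<^sub>u(T)\<close>, so of \<open>e\<^bsup>u - \<kappa>\<^esup> \<P>\<close>.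
\<close>

section \<open>Copies of sets and tiles\<close>

lemma copy_copy: "copy v \<alpha> (copy w \<beta> A) = copy (v + \<alpha> *\<^sub>R w) (\<alpha> * \<beta>) A"
  by (simp add: copy_def image_image algebra_simps)

lemma copy_0_1 [simp]: "copy 0 1 A = A"
  by (simp add: copy_def)

lemma vol_copy:
  fixes A :: "'a::euclidean_space set"
  shows "vol (copy v \<alpha> A) = \<bar>\<alpha>\<bar> ^ DIM('a) * vol A"
  using measure_lebesgue_affine[of \<alpha> v A] by (simp add: copy_def add.commute)

lemma vol_copy_prototile:
  fixes \<sigma> :: "'a::euclidean_space scheme"
  assumes "normalized \<sigma>" "j < num_types \<sigma>" "\<alpha> > 0"
  shows "vol (copy v \<alpha> (prototile \<sigma> j)) = \<alpha> ^ DIM('a)"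
  using assms by (simp add: vol_copy normalized_def)

lemma vol_copy_prototile_le_1_iff:
  fixes \<sigma> :: "'a::euclidean_space scheme"
  assumes "normalized \<sigma>" "j < num_types \<sigma>" "\<alpha> > 0"
  shows "vol (copy v \<alpha> (prototile \<sigma> j)) \<le> 1 \<longleftrightarrow> \<alpha> \<le> 1"
proof -
  have "\<alpha> ^ DIM('a) \<le> 1 \<longleftrightarrow> \<alpha> \<le> 1"
    using power_mono_iff[of \<alpha> 1 "DIM('a)"] assms(3) by simp
  then show ?thesis
    using assms by (simp add: vol_copy_prototile)
qed

lemma scale_unique:
  fixes \<sigma> :: "'a::euclidean_space scheme"
  assumes "normalized \<sigma>" "i < num_types \<sigma>" "j < num_types \<sigma>" "\<alpha> > 0" "\<beta> > 0"
    and "copy v \<alpha> (prototile \<sigma> i) = copy w \<beta> (prototile \<sigma> j)"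
  shows "\<alpha> = \<beta>"
proof -
  have "\<alpha> ^ DIM('a) = \<beta> ^ DIM('a)"
    using assms vol_copy_prototile[of \<sigma> i \<alpha> v] vol_copy_prototile[of \<sigma> j \<beta> w] by simp
  then show ?thesis
    using assms by (meson DIM_positive less_imp_le power_eq_imp_eq_base)
qed

lemma type_unique:
  assumes "geometrically_different \<sigma>" "i < num_types \<sigma>" "j < num_types \<sigma>"
    and "has_type \<sigma> i X" "has_type \<sigma> j X"
  shows "i = j"
proof (rule ccontr)
  assume "i \<noteq> j"
  obtain v \<alpha> where va: "\<alpha> > 0" "X = copy v \<alpha> (prototile \<sigma> i)"
    using assms(4) by (auto simp: has_type_def)
  obtain w \<beta> where wb: "\<beta> > 0" "X = copy w \<beta> (prototile \<sigma> j)"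
    using assms(5) by (auto simp: has_type_def)
  have "prototile \<sigma> i = copy (- (1/\<alpha>) *\<^sub>R v) (1/\<alpha>) X"
    using va by (simp add: copy_copy)
  also have "\<dots> = copy (- (1/\<alpha>) *\<^sub>R v + (1/\<alpha>) *\<^sub>R w) (1/\<alpha> * \<beta>) (prototile \<sigma> j)"
    using wb(2) by (simp only: copy_copy)
  finally have "has_type \<sigma> j (prototile \<sigma> i)"
    unfolding has_type_def using va(1) wb(1) by (metis mult_pos_pos zero_less_divide_1_iff)
  then show False
    using assms(1-3) \<open>i \<noteq> j\<close> by (auto simp: geometrically_different_def)
qed

lemma has_type_copy:
  assumes "\<alpha> > 0"
  shows "has_type \<sigma> i (copy v \<alpha> (prototile \<sigma> i))"
  using assms by (auto simp: has_type_def)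


section \<open>The substitution process\<close>

lemma pieces_trans:
  assumes "S \<in> pieces \<sigma> Y" "Y \<in> pieces \<sigma> X"
  shows "S \<in> pieces \<sigma> X"
  using assms by induction (auto intro: pieces.subst)

lemma pieces_translate:
  assumes "S \<in> pieces \<sigma> X"
  shows "copy w 1 S \<in> pieces \<sigma> (copy w 1 X)"
  using assms
proof induction
  case start
  show ?case by (rule pieces.start)
next
  case (subst v \<alpha> j R)
  have "copy (w + v) \<alpha> R \<in> pieces \<sigma> (copy w 1 X)"
  proof (rule pieces.subst)
    show "copy (w + v) \<alpha> (prototile \<sigma> j) \<in> pieces \<sigma> (copy w 1 X)"
      using subst.IH by (simp add: copy_copy)
    show "vol (copy (w + v) \<alpha> (prototile \<sigma> j)) > 1"
      using subst.hyps by (simp add: vol_copy)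
  qed (use subst.hyps in auto)
  then show ?case by (simp add: copy_copy)
qed

lemma pieces_small:
  assumes "vol X \<le> 1"
  shows "pieces \<sigma> X = {X}"
proof -
  have "S = X" if "S \<in> pieces \<sigma> X" for S
    using that by induction (use assms in auto)
  then show ?thesis
    using pieces.start[of X \<sigma>] by blast
qed

text \<open>The ratios of the walks from \<open>i\<close>: the products of the scales along chains of nested tiles,
  each in the rule of the preceding one, which start with the prototile \<open>i\<close>.\<close>

inductive descends :: "'a::euclidean_space scheme \<Rightarrow> nat \<Rightarrow> nat \<Rightarrow> real \<Rightarrow> bool"
  for \<sigma> :: "'a scheme" and i :: nat where
  refl: "descends \<sigma> i i 1"
| step: "\<lbrakk>descends \<sigma> i j \<beta>; j < num_types \<sigma>; k < num_types \<sigma>; 0 < \<alpha>; \<alpha> < 1;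
    copy v \<alpha> (prototile \<sigma> k) \<in> rule \<sigma> j\<rbrakk> \<Longrightarrow> descends \<sigma> i k (\<beta> * \<alpha>)"

lemma descends_pos:
  assumes "descends \<sigma> i j \<beta>"
  shows "\<beta> > 0"
  using assms by induction auto

lemma descends_le_1:
  assumes "descends \<sigma> i j \<beta>"
  shows "\<beta> \<le> 1"
  using assms by induction (auto dest: descends_pos intro: mult_le_one)

lemma descends_trans:
  assumes "descends \<sigma> j k \<gamma>" "descends \<sigma> i j \<beta>"
  shows "descends \<sigma> i k (\<beta> * \<gamma>)"
  using assms
proof induction
  case refl
  then show ?case by simp
next
  case (step j' \<beta>' k' \<alpha> v)
  then show ?case
    using descends.step[of \<sigma> i j' "\<beta> * \<beta>'" k' \<alpha> v] by (simp add: mult.assoc)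
qed

lemma descends_power:
  assumes "descends \<sigma> j j \<beta>"
  shows "descends \<sigma> j j (\<beta> ^ n)"
proof (induction n)
  case 0
  show ?case using descends.refl by simp
next
  case (Suc n)
  show ?case using descends_trans[OF Suc assms] by simp
qed

text \<open>Scales decrease along a walk, so if the last tile is larger than \<open>1\<close> then so are all
  preceding ones, and each of them was substituted.\<close>

lemma descends_imp_piece:
  fixes \<sigma> :: "'a::euclidean_space scheme"
  assumes "normalized \<sigma>" "descends \<sigma> i j \<beta>" "\<gamma> > 0" "\<gamma> * \<beta> > 1"
  shows "\<exists>v. copy v (\<gamma> * \<beta>) (prototile \<sigma> j) \<in> pieces \<sigma> (copy w \<gamma> (prototile \<sigma> i))"
  using assms(2,4)
proof induction
  case refl
  show ?case using pieces.start by (metis mult_1_right)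
next
  case (step j \<beta> k \<alpha> u)
  have pos: "\<gamma> * \<beta> > 0"
    using descends_pos[OF step.hyps(1)] \<open>\<gamma> > 0\<close> by simp
  have "\<gamma> * \<beta> * \<alpha> < \<gamma> * \<beta>"
    using pos mult_strict_left_mono[OF step.hyps(5) pos] by simp
  then have gt: "\<gamma> * \<beta> > 1"
    using step.prems by (simp add: mult.assoc)
  then obtain v where v: "copy v (\<gamma> * \<beta>) (prototile \<sigma> j) \<in> pieces \<sigma> (copy w \<gamma> (prototile \<sigma> i))"
    using step.IH by blast
  have "vol (copy v (\<gamma> * \<beta>) (prototile \<sigma> j)) > 1"
    using vol_copy_prototile_le_1_iff[OF assms(1) step.hyps(2) pos, of v] gt by linarith
  from pieces.subst[OF v step.hyps(2) pos this step.hyps(6)] show ?case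
    by (auto simp: copy_copy mult.assoc)
qed

text \<open>The converse. A piece is substituted according to any of its presentations as a copy of a
  prototile; type and scale do not depend on the presentation, so the walk is well defined.\<close>

lemma piece_imp_descends:
  fixes \<sigma> :: "'a::euclidean_space scheme"
  assumes "multiscale_scheme \<sigma>" "normalized \<sigma>" "geometrically_different \<sigma>"
    and "i < num_types \<sigma>" "\<gamma> > 0" "S \<in> pieces \<sigma> (copy w \<gamma> (prototile \<sigma> i))"
  shows "\<exists>k v \<beta>. k < num_types \<sigma> \<and> S = copy v (\<gamma> * \<beta>) (prototile \<sigma> k) \<and> descends \<sigma> i k \<beta>"
  using assms(6)
proof induction
  case start
  show ?case
    using assms(4) descends.refl by (metis mult_1_right)
next
  case (subst v \<alpha> j R)
  obtain k u \<beta> where k: "k < num_types \<sigma>" "descends \<sigma> i k \<beta>"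
    and eq: "copy v \<alpha> (prototile \<sigma> j) = copy u (\<gamma> * \<beta>) (prototile \<sigma> k)"
    using subst.IH by blast
  have pos: "\<gamma> * \<beta> > 0"
    using descends_pos[OF k(2)] \<open>\<gamma> > 0\<close> by simp
  have "j = k"
    using type_unique[OF assms(3) subst.hyps(2) k(1)] eq has_type_copy subst.hyps(3) pos by metis
  moreover have "\<alpha> = \<gamma> * \<beta>"
    using scale_unique[OF assms(2) subst.hyps(2) k(1) subst.hyps(3) pos eq] .
  moreover obtain k' u' \<alpha>' where R: "k' < num_types \<sigma>" "0 < \<alpha>'" "\<alpha>' < 1"
    "R = copy u' \<alpha>' (prototile \<sigma> k')"
    using assms(1) subst.hyps unfolding multiscale_scheme_def by blast
  ultimately have "descends \<sigma> i k' (\<beta> * \<alpha>')"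
    "copy v \<alpha> R = copy (v + \<alpha> *\<^sub>R u') (\<gamma> * (\<beta> * \<alpha>')) (prototile \<sigma> k')"
    using descends.step[OF k(2)] k(1) subst.hyps by (auto simp: copy_copy mult.assoc)
  then show ?case
    using R(1) by blast
qed


section \<open>Closed walks incommensurable with a given number\<close>

lemma irreducible_imp_descends:
  fixes \<sigma> :: "'a::euclidean_space scheme"
  assumes "multiscale_scheme \<sigma>" "normalized \<sigma>" "geometrically_different \<sigma>" "irreducible_scheme \<sigma>"
    and "i < num_types \<sigma>" "j < num_types \<sigma>"
  shows "\<exists>\<beta>. descends \<sigma> i j \<beta>"
proof -
  obtain t S where S: "S \<in> pieces \<sigma> (copy 0 (exp t) (prototile \<sigma> i))" "has_type \<sigma> j S"
    using assms(4-6) unfolding irreducible_scheme_def flow_def by blast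
  then obtain k v \<beta> where k: "k < num_types \<sigma>" "S = copy v (exp t * \<beta>) (prototile \<sigma> k)"
    "descends \<sigma> i k \<beta>"
    using piece_imp_descends[OF assms(1-3,5) _ S(1)] by auto
  then have "has_type \<sigma> k S"
    using has_type_copy descends_pos by (metis exp_gt_zero mult_pos_pos)
  then show ?thesis
    using type_unique[OF assms(3) k(1) assms(6)] S(2) k(3) by blast
qed

lemma return_time_imp_descends:
  fixes \<sigma> :: "'a::euclidean_space scheme"
  assumes "multiscale_scheme \<sigma>" "normalized \<sigma>" "geometrically_different \<sigma>"
    and "i < num_types \<sigma>" "t \<in> return_times \<sigma> i"
  shows "descends \<sigma> i i (exp (- t))"
proof -
  obtain S where S: "S \<in> pieces \<sigma> (copy 0 (exp t) (prototile \<sigma> i))" "has_type \<sigma> i S" "vol S = 1"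
    using assms(5) by (auto simp: return_times_def flow_def)
  then obtain k v \<beta> where k: "k < num_types \<sigma>" "S = copy v (exp t * \<beta>) (prototile \<sigma> k)"
    "descends \<sigma> i k \<beta>"
    using piece_imp_descends[OF assms(1-4) _ S(1)] by auto
  have pos: "exp t * \<beta> > 0"
    using descends_pos[OF k(3)] by simp
  have "k = i"
    using type_unique[OF assms(3) k(1) assms(4)] S(2) k(2) has_type_copy[OF pos] by blast
  have "(exp t * \<beta>) ^ DIM('a) = 1 ^ DIM('a)"
    using vol_copy_prototile[OF assms(2) k(1) pos, of v] k(2) S(3) by simp
  then have "exp t * \<beta> = 1"
    using pos by (meson DIM_positive less_imp_le power_eq_imp_eq_base zero_le_one)
  then have "\<beta> = exp (- t)"
    by (simp add: exp_minus field_simps)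
  then show ?thesis
    using k(3) \<open>k = i\<close> by simp
qed

text \<open>Make a detour from \<open>j\<close> to \<open>i\<close> and back, with and without going around a closed walk of length
  \<open>t\<close> at \<open>i\<close>. The lengths of the two resulting closed walks at \<open>j\<close> differ by \<open>t\<close>, so if all closed
  walks at \<open>j\<close> had a length in \<open>\<rat> s\<close>, then every return time would be in \<open>\<rat> s\<close>, and any two of them
  would be commensurable.\<close>

lemma loop_incommensurable_with:
  fixes \<sigma> :: "'a::euclidean_space scheme"
  assumes "multiscale_scheme \<sigma>" "normalized \<sigma>" "geometrically_different \<sigma>"
    and "irreducible_scheme \<sigma>" "incommensurable \<sigma>" "j < num_types \<sigma>"
  obtains \<beta> where "descends \<sigma> j j \<beta>" "\<forall>q\<in>\<rat>. - ln \<beta> \<noteq> q * s"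
proof -
  have "\<exists>\<beta>. descends \<sigma> j j \<beta> \<and> (\<forall>q\<in>\<rat>. - ln \<beta> \<noteq> q * s)"
  proof (rule ccontr)
    assume "\<not> ?thesis"
    then have rational: "\<exists>q\<in>\<rat>. - ln \<beta> = q * s" if "descends \<sigma> j j \<beta>" for \<beta>
      using that by blast
    have return_rational: "\<exists>q\<in>\<rat>. t = q * s" if i: "i < num_types \<sigma>" "t \<in> return_times \<sigma> i" for i t
    proof -
      obtain \<beta> \<gamma> where bg: "descends \<sigma> j i \<beta>" "descends \<sigma> i j \<gamma>"
        using irreducible_imp_descends[OF assms(1-4)] assms(6) i(1) by metis
      have pos: "\<beta> > 0" "\<gamma> > 0"
        using bg by (simp_all add: descends_pos)
      have "descends \<sigma> i j (exp (- t) * \<gamma>)"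
        by (rule descends_trans[OF bg(2) return_time_imp_descends[OF assms(1-3) i]])
      then have "descends \<sigma> j j (\<beta> * (exp (- t) * \<gamma>))" "descends \<sigma> j j (\<beta> * \<gamma>)"
        using bg descends_trans by blast+
      then obtain p q where pq: "p \<in> \<rat>" "q \<in> \<rat>"
        "- ln (\<beta> * (exp (- t) * \<gamma>)) = p * s" "- ln (\<beta> * \<gamma>) = q * s"
        using rational by metis
      have "t = (p - q) * s"
        using pq(3,4) pos by (simp add: ln_mult algebra_simps)
      then show ?thesis
        using pq(1,2) Rats_diff by blast
    qed
    obtain i k t u where iku: "i < num_types \<sigma>" "k < num_types \<sigma>" "t \<in> return_times \<sigma> i"
      "u \<in> return_times \<sigma> k" "u > 0" and irr: "\<forall>q\<in>\<rat>. t \<noteq> q * u"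
      using assms(5) unfolding incommensurable_def by blast
    obtain p q where pq: "p \<in> \<rat>" "q \<in> \<rat>" "t = p * s" "u = q * s"
      using return_rational iku by metis
    have "q \<noteq> 0"
      using iku(5) pq(4) by auto
    then have "t = (p / q) * u"
      using pq by simp
    then show False
      using irr pq(1,2) Rats_divide by blast
  qed
  then show thesis
    using that by blast
qed


section \<open>Density of natural differences\<close>

text \<open>Kronecker's theorem approximates \<open>x / \<l>\<close> by \<open>k \<theta> - h\<close>, where \<open>\<theta> = s / \<l>\<close>, but leaves the
  sign of \<open>h\<close> open. Approximating \<open>x / \<l> - M \<theta>\<close> with a large \<open>M\<close> instead forces \<open>h \<ge> 0\<close>.\<close>

lemma natural_differences_dense:
  fixes s \<l> :: real
  assumes "s > 0" "\<l> > 0" and irr: "\<forall>q\<in>\<rat>. \<l> \<noteq> q * s"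
  shows "closure {real m * s - real n * \<l> | m n. True} = UNIV"
proof -
  define \<theta> where "\<theta> = s / \<l>"
  have pos: "\<theta> > 0" using assms by (simp add: \<theta>_def)
  have "\<theta> \<notin> \<rat>"
  proof
    assume "\<theta> \<in> \<rat>"
    then have "inverse \<theta> \<in> \<rat>" by simp
    moreover have "\<l> = inverse \<theta> * s" using assms by (simp add: \<theta>_def)
    ultimately show False using irr by blast
  qed
  have "\<exists>y \<in> {real m * s - real n * \<l> | m n. True}. dist y x < e" if e: "e > 0" for x e
  proof -
    obtain M :: nat where M: "real M * \<theta> > x / \<l> + e / \<l>"
      using reals_Archimedean3[OF pos] by blast
    have "e / \<l> > 0" using e assms by simp
    then obtain h k where k: "k > 0" and
      hk: "\<bar>of_int k * \<theta> - of_int h - (x / \<l> - real M * \<theta>)\<bar> < e / \<l>"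
      by (rule sequence_of_fractional_parts_is_dense[OF \<open>\<theta> \<notin> \<rat>\<close>])
    have "of_int k * \<theta> > 0" using k pos by simp
    then have "real_of_int h > 0" using hk M by linarith
    then have h: "h \<ge> 0" by linarith
    define m n where "m = nat k + M" and "n = nat h"
    have mn: "real m = of_int k + real M" "real n = of_int h"
      using k h by (simp_all add: m_def n_def)
    have "real m * s - real n * \<l> - x = \<l> * (of_int k * \<theta> - of_int h - (x / \<l> - real M * \<theta>))"
      using assms by (simp add: mn \<theta>_def field_simps)
    then have "\<bar>real m * s - real n * \<l> - x\<bar> < \<l> * (e / \<l>)"
      using hk assms(2) by (simp add: abs_mult del: times_divide_eq_right)
    then have "dist (real m * s - real n * \<l>) x < e"
      using assms(2) by (simp add: dist_real_def)
    then show ?thesis by blast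
  qed
  then have "x \<in> closure {real m * s - real n * \<l> | m n. True}" for x
    by (simp only: closure_approachable) blast
  then show ?thesis by blast
qed

lemma closure_Int_interval_if_dense:
  fixes J D :: "real set"
  assumes "is_interval J" "a \<in> J" "t \<in> J" "a \<noteq> t" "closure D = UNIV"
  shows "t \<in> closure (J \<inter> D)"
proof -
  define I where "I = {min a t<..<max a t}"
  have "I \<subseteq> J"
  proof
    fix x assume "x \<in> I"
    then have "min a t \<le> x" "x \<le> max a t" by (simp_all add: I_def)
    moreover have "min a t \<in> J" "max a t \<in> J"
      using assms(2,3) by (simp_all add: min_def max_def)
    ultimately show "x \<in> J"
      using assms(1) mem_is_interval_1_I by blast
  qed
  have "t \<in> closure I"
    using assms(4) by (auto simp: I_def min_def max_def)
  also have "closure I = closure (I \<inter> D)"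
    using closure_open_Int_superset[of I D] assms(5) by (simp add: I_def)
  also have "\<dots> \<subseteq> closure (J \<inter> D)"
    using \<open>I \<subseteq> J\<close> by (intro closure_mono) blast
  finally show ?thesis .
qed


section \<open>Translated patches in the stationary tiling\<close>

text \<open>What makes going around a closed walk available is that \<open>e\<^sup>t T\<close> has volume \<open>> 1\<close> at every legal
  time \<open>t\<close>. Otherwise \<open>F\<^sub>t(T)\<close> is the single tile \<open>e\<^sup>t T\<close>, so that \<open>Q\<close>, a tile of the patch, would have
  to be \<open>e\<^sup>\<kappa> T\<close>. As \<open>Q\<close> lies in \<open>F\<^sub>\<kappa>(T)\<close>, its volume would be at most \<open>1\<close>, and since \<open>\<kappa> \<ge> s\<close> the patches
  \<open>F\<^sub>0(T) = {T}\<close> and \<open>F\<^sub>s(T) = {e\<^sup>s T}\<close> would not be nested.\<close>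

lemma substituted_at_legal_time:
  fixes \<sigma> :: "'a::euclidean_space scheme"
  assumes "normalized \<sigma>" and j: "j < num_types \<sigma>" "c > 0" "T = copy x c (prototile \<sigma> j)"
    and "s > 0" and nested: "flow \<sigma> 0 T \<subseteq> flow \<sigma> s T"
    and "\<kappa> \<ge> s" "Q \<in> flow \<sigma> \<kappa> T" "copy 0 (exp (t - \<kappa>)) Q \<in> flow \<sigma> t T"
  shows "exp t * c > 1"
proof (rule ccontr)
  assume small: "\<not> exp t * c > 1"
  have T: "copy 0 (exp u) T = copy (exp u *\<^sub>R x) (exp u * c) (prototile \<sigma> j)" for u
    by (simp add: j copy_copy)
  have vol_le: "vol (copy 0 (exp u) T) \<le> 1 \<longleftrightarrow> exp u * c \<le> 1" for u
    unfolding T using vol_copy_prototile_le_1_iff[OF assms(1) j(1)] j(2) by simp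
  have flow_small: "flow \<sigma> u T = {copy 0 (exp u) T}" if "exp u * c \<le> 1" for u
    using that vol_le[of u] pieces_small[of "copy 0 (exp u) T" \<sigma>] by (auto simp: flow_def)
  have "copy 0 (exp (t - \<kappa>)) Q = copy 0 (exp t) T"
    using assms(9) flow_small[of t] small by simp
  then have "copy 0 (exp (\<kappa> - t)) (copy 0 (exp (t - \<kappa>)) Q) = copy 0 (exp (\<kappa> - t)) (copy 0 (exp t) T)"
    by simp
  then have "Q = copy 0 (exp \<kappa>) T"
    by (simp add: copy_copy mult_exp_exp)
  then have "exp \<kappa> * c \<le> 1"
    using assms(8) vol_le by (simp add: flow_def)
  have le: "exp u * c \<le> 1" if "u \<le> s" for u
  proof -
    have "exp u * c \<le> exp \<kappa> * c"
      using that assms(7) j(2) by (intro mult_right_mono) auto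
    then show ?thesis
      using \<open>exp \<kappa> * c \<le> 1\<close> by linarith
  qed
  have "copy 0 (exp 0) T = copy 0 (exp s) T"
    using nested flow_small[OF le[of 0]] flow_small[OF le[of s]] assms(5) by simp
  then have "exp 0 * c = exp s * c"
    unfolding T by (intro scale_unique[OF assms(1) j(1) j(1)]) (use j(2) in auto)
  then show False
    using assms(5) j(2) by simp
qed

lemma translated_flow_in_tiling:
  fixes \<sigma> :: "'a::euclidean_space scheme"
  assumes "normalized \<sigma>" "c > 0" and T: "T = copy x c (prototile \<sigma> j)"
    and "descends \<sigma> j j \<beta>" and u: "u = real m * s - real n * (- ln \<beta>)" and "exp u * c > 1"
    and \<S>: "\<S> = (\<Union>k :: nat. flow \<sigma> (real k * s) T)"
  shows "\<exists>w. (copy w 1) ` flow \<sigma> u T \<subseteq> \<S>"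
proof -
  define b where "b = exp (real m * s) * c"
  have "exp (real n * ln \<beta>) = \<beta> ^ n"
    using descends_pos[OF assms(4)] by (simp add: exp_of_nat_mult)
  then have scale: "exp u * c = b * \<beta> ^ n"
    by (simp add: u b_def exp_add mult_ac)
  have b: "b > 0" using assms(2) by (simp add: b_def)
  obtain v where v: "copy v (b * \<beta> ^ n) (prototile \<sigma> j)
      \<in> pieces \<sigma> (copy (exp (real m * s) *\<^sub>R x) b (prototile \<sigma> j))"
    using descends_imp_piece[OF assms(1) descends_power[OF assms(4)] b] assms(6) scale by metis
  define w where "w = v - exp u *\<^sub>R x"
  have translate: "copy w 1 (copy 0 (exp u) T) = copy v (b * \<beta> ^ n) (prototile \<sigma> j)"
    by (simp add: T copy_copy w_def scale)
  have target: "copy (exp (real m * s) *\<^sub>R x) b (prototile \<sigma> j) = copy 0 (exp (real m * s)) T"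
    by (simp add: T copy_copy b_def)
  have "copy w 1 S \<in> flow \<sigma> (real m * s) T" if "S \<in> flow \<sigma> u T" for S
  proof -
    have "copy w 1 S \<in> pieces \<sigma> (copy v (b * \<beta> ^ n) (prototile \<sigma> j))"
      using that pieces_translate[of S \<sigma> "copy 0 (exp u) T" w] by (simp add: flow_def translate)
    then have "copy w 1 S \<in> pieces \<sigma> (copy 0 (exp (real m * s)) T)"
      using pieces_trans v target by metis
    then show ?thesis
      using that by (simp add: flow_def vol_copy)
  qed
  then show ?thesis
    using \<S> by blast
qed

lemma entry_index_works:
  assumes "presented_by \<sigma> s T \<S>" "finite \<P>" "\<P> \<subseteq> \<S>"
  shows "entry_index \<sigma> s T \<P> \<ge> 1 \<and> \<P> \<subseteq> flow \<sigma> (real (entry_index \<sigma> s T \<P>) * s) T"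
proof -
  let ?f = "\<lambda>k :: nat. flow \<sigma> (real k * s) T"
  have "?f k \<subseteq> ?f (Suc k)" for k
    using assms(1) unfolding presented_by_def by blast
  then have mono: "?f k \<subseteq> ?f l" if "k \<le> l" for k l
    using lift_Suc_mono_le[of ?f] that by blast
  have "\<forall>Q\<in>\<P>. \<exists>k. Q \<in> ?f k"
    using assms(1,3) by (auto simp: presented_by_def)
  then obtain g where g: "\<And>Q. Q \<in> \<P> \<Longrightarrow> Q \<in> ?f (g Q)"
    by metis
  have "Q \<in> ?f (Suc (Max (g ` \<P>)))" if "Q \<in> \<P>" for Q
  proof -
    have "g Q \<le> Suc (Max (g ` \<P>))"
      using assms(2) that by (simp add: le_SucI)
    then show ?thesis using g[OF that] mono by blast
  qed
  then have "\<P> \<subseteq> ?f (Suc (Max (g ` \<P>)))" by blast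
  then show ?thesis
    unfolding entry_index_def
    by (intro LeastI[of "\<lambda>k. k \<ge> 1 \<and> \<P> \<subseteq> ?f k" "Suc (Max (g ` \<P>))"]) simp
qed


theorem lemma5p7:
  fixes \<sigma> :: "'a::euclidean_space scheme"
    and s :: real and T :: "'a set" and \<S> \<P> :: "'a set set"
  assumes "multiscale_scheme \<sigma>"
    and "normalized \<sigma>"
    and "geometrically_different \<sigma>"
    and "irreducible_scheme \<sigma>"
    and "incommensurable \<sigma>"
    and "stationary_tiling \<sigma> s \<S>"
    and "presented_by \<sigma> s T \<S>"
    and "\<P> \<subseteq> \<S>" and "patch \<P>" and "finite \<P>" and "\<P> \<noteq> {}"
  shows "legal_scales \<sigma> s T \<S> \<P> \<subseteq> closure (Scales \<S> \<P> \<inter> legal_scales \<sigma> s T \<S> \<P>)"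
proof
  fix \<alpha> assume "\<alpha> \<in> legal_scales \<sigma> s T \<S> \<P>"
  then obtain v where v: "copy v 1 ` \<P> \<subseteq> \<S>"
    and \<alpha>: "\<alpha> \<in> local_legal_scales \<sigma> s T (copy v 1 ` \<P>)"
    by (auto simp: legal_scales_def)
  define \<P>' where "\<P>' = copy v 1 ` \<P>"
  define \<kappa> where "\<kappa> = real (entry_index \<sigma> s T \<P>') * s"
  define G where "G = {t. copy 0 (exp (t - \<kappa>)) ` \<P>' \<subseteq> flow \<sigma> t T}"
  have local: "local_legal_scales \<sigma> s T \<P>' = (\<lambda>t. exp (t - \<kappa>)) ` maximal_interval G \<kappa>"
    by (simp add: local_legal_scales_def legal_times_def Let_def \<kappa>_def G_def)
  obtain t J where t: "\<alpha> = exp (t - \<kappa>)" "t \<in> J" and J: "is_interval J" "\<kappa> \<in> J" "J \<subseteq> G"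
    using \<alpha> unfolding \<P>'_def[symmetric] local maximal_interval_def by blast
  have legal: "exp (u - \<kappa>) \<in> legal_scales \<sigma> s T \<S> \<P>" if "u \<in> J" for u
  proof -
    have "u \<in> maximal_interval G \<kappa>"
      using that J by (auto simp: maximal_interval_def)
    then have "exp (u - \<kappa>) \<in> local_legal_scales \<sigma> s T \<P>'"
      by (simp add: local)
    then show ?thesis
      using v by (auto simp: legal_scales_def \<P>'_def)
  qed
  have scale: "exp (u - \<kappa>) \<in> Scales \<S> \<P>"
    if "u \<in> G" and w: "copy w 1 ` flow \<sigma> u T \<subseteq> \<S>" for u w
  proof -
    have "copy (w + exp (u - \<kappa>) *\<^sub>R v) (exp (u - \<kappa>)) Q \<in> \<S>" if "Q \<in> \<P>" for Q
    proof -
      have "copy 0 (exp (u - \<kappa>)) (copy v 1 Q) \<in> flow \<sigma> u T"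
        using \<open>u \<in> G\<close> that by (auto simp: G_def \<P>'_def)
      then have "copy w 1 (copy 0 (exp (u - \<kappa>)) (copy v 1 Q)) \<in> \<S>"
        using w by blast
      then show ?thesis
        by (simp add: copy_copy)
    qed
    then show ?thesis
      by (auto simp: Scales_def)
  qed
  show "\<alpha> \<in> closure (Scales \<S> \<P> \<inter> legal_scales \<sigma> s T \<S> \<P>)"
  proof (cases "t = \<kappa>")
    case True
    \<comment> \<open>Here \<open>J\<close> may be the single point \<open>\<kappa>\<close>, which no dense set of times has to meet.\<close>
    have "\<alpha> = 1" using True t(1) by simp
    moreover have "1 \<in> Scales \<S> \<P>"
      using v by (auto simp: Scales_def)
    ultimately show ?thesis
      using legal[OF t(2)] t(1) by (intro subsetD[OF closure_subset]) auto
  next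
    case False
    obtain j c x where j: "j < num_types \<sigma>" "c > 0" "T = copy x c (prototile \<sigma> j)"
      using assms(7) by (auto simp: presented_by_def has_type_def)
    have s: "s > 0"
      using assms(6) by (auto simp: stationary_tiling_def)
    have nested: "flow \<sigma> 0 T \<subseteq> flow \<sigma> s T"
    proof -
      have "flow \<sigma> (real 0 * s) T \<subseteq> flow \<sigma> (real (Suc 0) * s) T"
        using assms(7) unfolding presented_by_def by blast
      then show ?thesis by simp
    qed
    have \<S>: "\<S> = (\<Union>k :: nat. flow \<sigma> (real k * s) T)"
      using assms(7) by (simp add: presented_by_def)
    have entry: "entry_index \<sigma> s T \<P>' \<ge> 1" "\<P>' \<subseteq> flow \<sigma> \<kappa> T"
      using entry_index_works[OF assms(7), of \<P>'] assms(10) v by (simp_all add: \<P>'_def \<kappa>_def)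
    have "\<kappa> \<ge> s"
      using entry(1) s by (simp add: \<kappa>_def)
    obtain Q where Q: "Q \<in> \<P>'"
      using assms(11) by (auto simp: \<P>'_def)
    have large: "exp u * c > 1" if "u \<in> J" for u
    proof (rule substituted_at_legal_time[OF assms(2) j s nested \<open>\<kappa> \<ge> s\<close>])
      show "Q \<in> flow \<sigma> \<kappa> T" using Q entry(2) by blast
      show "copy 0 (exp (u - \<kappa>)) Q \<in> flow \<sigma> u T"
        using Q that J(3) by (auto simp: G_def)
    qed
    obtain \<beta> where \<beta>: "descends \<sigma> j j \<beta>" "\<forall>q\<in>\<rat>. - ln \<beta> \<noteq> q * s"
      using loop_incommensurable_with[OF assms(1-5) j(1)] by metis
    define D where "D = {real m * s - real n * (- ln \<beta>) | m n. True}"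
    have "\<beta> \<noteq> 1"
      using \<beta>(2) Rats_0 by force
    then have "- ln \<beta> > 0"
      using descends_pos[OF \<beta>(1)] descends_le_1[OF \<beta>(1)] by simp
    then have "closure D = UNIV"
      unfolding D_def using natural_differences_dense s \<beta>(2) by blast
    then have "t \<in> closure (J \<inter> D)"
      using closure_Int_interval_if_dense[OF J(1,2) t(2)] False by blast
    moreover have "exp (u - \<kappa>) \<in> Scales \<S> \<P> \<inter> legal_scales \<sigma> s T \<S> \<P>" if u: "u \<in> J \<inter> D" for u
    proof -
      obtain m n where mn: "u = real m * s - real n * (- ln \<beta>)"
        using u unfolding D_def by blast
      have "u \<in> J"
        using u by blast
      obtain w where "copy w 1 ` flow \<sigma> u T \<subseteq> \<S>"
        using translated_flow_in_tiling[OF assms(2) j(2,3) \<beta>(1) mn large[OF \<open>u \<in> J\<close>] \<S>]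
        by blast
      then show ?thesis
        using scale legal \<open>u \<in> J\<close> J(3) by blast
    qed
    ultimately have "(\<lambda>u. exp (u - \<kappa>)) t \<in> closure (Scales \<S> \<P> \<inter> legal_scales \<sigma> s T \<S> \<P>)"
      using image_closure_subset[of "J \<inter> D" "\<lambda>u. exp (u - \<kappa>)"
          "closure (Scales \<S> \<P> \<inter> legal_scales \<sigma> s T \<S> \<P>)"] closure_subset
      by (force intro!: continuous_intros)
    then show ?thesis
      using t(1) by simp
  qed
qed

end
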